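(* Let $M$ be a nonsingular totally positive $n\times n$ matrix, let $E=U_i(\lambda)$ or $E=L_i(\lambda)$ be an elementary $n\times n$ matrix (as defined in the context) with $0\le\lambda<1$, and let $A:=ME$ and $C:=E^TM$. Then the following properties hold: (i) $|A^{-1}|$ and $|C^{-1}|$ dominate $M^{-1}$. (ii) The minimal eigenvalues of $A$ and of $C$ are bounded above by the minimal eigenvalue of $M$. (iii) The minimal singular values of $A$ and of $C$ are bounded above by the minimal singular value of $M$. (iv) $\kappa_\infty(M)\le\kappa_\infty(A)$ and $\kappa_1(M)\le\kappa_1(C)$.
   Context: A real matrix is totally positive (TP) if all its minors are nonnegative. All eigenvalues of a nonsingular TP matrix are real and positive, and products of TP matrices are TP, so "minimal eigenvalue" means the smallest one. For $2\le i\le n$ and $0\le\lambda<1$: $U_i(\lambda)$ is the $n\times n$ matrix that coincides with the identity matrix except in row $i-1$, where the $(i-1,i-1)$ entry is $1-\lambda$ and the $(i-1,i)$ entry is $\lambda$. $L_i(\lambda)$ is the $n\times n$ matrix that coincides with the identity matrix except in row $i$, where the $(i,i-1)$ entry is $\lambda$ and the $(i,i)$ entry is $1-\lambda$. For a matrix $C=(c_{ij})$, $|C|:=(|c_{ij}|)$. A nonnegative matrix $B=(b_{ij})$ dominates a (real or complex) matrix $C=(c_{ij})$ of the same size if $|c_{ij}|\le b_{ij}$ for all $i,j$. For a nonsingular matrix $B$ and $p\in\{1,\infty\}$, $\kappa_p(B):=\|B\|_p\,\|B^{-1}\|_p$, where $\|\cdot\|_p$ is the matrix norm induced by the vector $p$-norm.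 *)

theory Defs
  imports
    Complex_Main
    "Jordan_Normal_Form.Determinant"
    "Jordan_Normal_Form.Char_Poly"
    "Jordan_Normal_Form.Gauss_Jordan_Elimination"
    "Jordan_Normal_Form.DL_Submatrix"
begin

definition totally_positive :: "real mat \<Rightarrow> bool" where
  "totally_positive A \<longleftrightarrow>
     (\<forall>I J. I \<subseteq> {..<dim_row A} \<longrightarrow> J \<subseteq> {..<dim_col A} \<longrightarrow> card I = card J \<longrightarrow>
        0 \<le> det (submatrix A I J))"

text \<open>
  Matrix entries are indexed from 0, while the index \<open>i\<close> of an elementary matrix ranges over
  \<open>2, \<dots>, n\<close>. So the mathematical row \<open>i - 1\<close> is row \<open>i - 2\<close> here, and row \<open>i\<close> is row \<open>i - 1\<close>.
\<close>

definition U_mat :: "nat \<Rightarrow> nat \<Rightarrow> real \<Rightarrow> real mat" where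
  "U_mat n i l = mat n n (\<lambda>(r, c).
     if (r, c) = (i - 2, i - 2) then 1 - l
     else if (r, c) = (i - 2, i - 1) then l
     else 1\<^sub>m n $$ (r, c))"

definition L_mat :: "nat \<Rightarrow> nat \<Rightarrow> real \<Rightarrow> real mat" where
  "L_mat n i l = mat n n (\<lambda>(r, c).
     if (r, c) = (i - 1, i - 2) then l
     else if (r, c) = (i - 1, i - 1) then 1 - l
     else 1\<^sub>m n $$ (r, c))"

text \<open>Only meaningful for nonsingular \<open>A\<close>.\<close>

definition mat_inv :: "real mat \<Rightarrow> real mat" where
  "mat_inv A = the (mat_inverse A)"

text \<open>\<open>norm\<close> is the absolute value on the entries, real or complex.\<close>

definition abs_mat :: "'a :: real_normed_field mat \<Rightarrow> real mat" where
  "abs_mat C = map_mat norm C"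

definition dominates :: "real mat \<Rightarrow> 'a :: real_normed_field mat \<Rightarrow> bool" where
  "dominates B C \<longleftrightarrow>
     dim_row B = dim_row C \<and> dim_col B = dim_col C \<and>
     (\<forall>i < dim_row B. \<forall>j < dim_col B. 0 \<le> B $$ (i, j) \<and> norm (C $$ (i, j)) \<le> B $$ (i, j))"

text \<open>
  The smallest real eigenvalue. It is only used for nonsingular totally positive matrices, all of
  whose complex eigenvalues are real and positive, and for Gram matrices, so that the minimum runs
  over the whole (nonempty, finite) spectrum.
\<close>

definition min_eigenvalue :: "real mat \<Rightarrow> real" where
  "min_eigenvalue A = Min {x. eigenvalue A x}"

definition min_singular_value :: "real mat \<Rightarrow> real" where
  "min_singular_value A = Min {sqrt x | x. eigenvalue (A\<^sup>T * A) x}"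

definition vec_norm_1 :: "real vec \<Rightarrow> real" where
  "vec_norm_1 v = (\<Sum>i < dim_vec v. \<bar>v $ i\<bar>)"

definition vec_norm_inf :: "real vec \<Rightarrow> real" where
  "vec_norm_inf v = Max {\<bar>v $ i\<bar> | i. i < dim_vec v}"

definition induced_norm :: "(real vec \<Rightarrow> real) \<Rightarrow> real mat \<Rightarrow> real" where
  "induced_norm N B = (SUP v \<in> carrier_vec (dim_col B) - {0\<^sub>v (dim_col B)}. N (B *\<^sub>v v) / N v)"

definition cond_number :: "(real vec \<Rightarrow> real) \<Rightarrow> real mat \<Rightarrow> real" where
  "cond_number N B = induced_norm N B * induced_norm N (mat_inv B)"

abbreviation kappa_1 :: "real mat \<Rightarrow> real" where
  "kappa_1 \<equiv> cond_number vec_norm_1"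

abbreviation kappa_inf :: "real mat \<Rightarrow> real" where
  "kappa_inf \<equiv> cond_number vec_norm_inf"

end

theory Submission
  imports Defs
begin

text \<open>
  The inverse of a nonsingular totally positive matrix has a checkerboard sign pattern, by the
  cofactor formula, and so does \<open>E\<^sup>-\<^sup>1\<close>. Products of checkerboard matrices involve no cancellation,
  and the diagonal of \<open>E\<^sup>-\<^sup>1\<close> is at least 1, which gives the domination. A checkerboard matrix is
  similar, via \<open>diag (1, -1, 1, \<dots>)\<close>, to its absolute value, so the smallest eigenvalue of \<open>M\<close> is the
  reciprocal of the Perron root of \<open>|M\<^sup>-\<^sup>1|\<close>, and Perron roots are monotone under domination; the same
  argument with \<open>M\<^sup>-\<^sup>1 (M\<^sup>-\<^sup>1)\<^sup>T\<close> handles the singular values. For the condition numbers, \<open>E\<close> is row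
  stochastic, so \<open>M\<close> and \<open>ME\<close> have the same row sums.
\<close>

section \<open>Nonnegative matrices and a weak Perron--Frobenius theorem\<close>

text \<open>The M-matrix property: a positive u with u - x Q u positive makes I - x Q
  inverse-nonnegative. If the minimum \<open>m\<close> of the ratios \<open>v j / u j\<close> were
  negative and attained at \<open>k\<close>, row \<open>k\<close> would give m u_k < m x (Q u)_k <=
  x (Q v)_k <= v_k = m u_k.\<close>

lemma semipositive_mono:
  fixes q :: "nat \<Rightarrow> nat \<Rightarrow> real"
  assumes q: "\<And>i j. i < n \<Longrightarrow> j < n \<Longrightarrow> 0 \<le> q i j"
    and u: "\<And>i. i < n \<Longrightarrow> 0 < u i" "\<And>i. i < n \<Longrightarrow> x * (\<Sum>j<n. q i j * u j) < u i"
    and x: "0 \<le> x"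
    and v: "\<And>i. i < n \<Longrightarrow> x * (\<Sum>j<n. q i j * v j) \<le> v i"
    and i: "i < n"
  shows "0 \<le> v i"
proof (rule ccontr)
  assume neg: "\<not> 0 \<le> v i"
  define r where "r j = v j / u j" for j
  define m where "m = Min (r ` {..<n})"
  have "m \<in> r ` {..<n}"
    unfolding m_def using i by (intro Min_in) auto
  then obtain k where k: "k < n" "r k = m" by auto
  have le: "m \<le> r j" if "j < n" for j
    unfolding m_def using that by (intro Min_le) auto
  have "r i < 0"
    using neg u(1)[OF i] by (simp add: r_def divide_neg_pos)
  with le[OF i] have m: "m < 0" by simp
  have vu: "m * u j \<le> v j" if "j < n" for j
    using le[OF that] u(1)[OF that] by (simp add: r_def field_simps)
  have "m * u k < m * (x * (\<Sum>j<n. q k j * u j))"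
    using u(2)[OF k(1)] m by simp
  also have "\<dots> = x * (\<Sum>j<n. q k j * (m * u j))"
    by (simp add: sum_distrib_left ac_simps)
  also have "\<dots> \<le> x * (\<Sum>j<n. q k j * v j)"
    using x q[OF k(1)] vu by (intro mult_left_mono sum_mono) auto
  also have "\<dots> \<le> v k" by (rule v[OF k(1)])
  also have "v k = m * u k"
    using k u(1)[OF k(1)] by (simp add: r_def field_simps)
  finally show False by simp
qed

lemma mult_mat_vec_index:
  assumes "A \<in> carrier_mat n n" "v \<in> carrier_vec n" "i < n"
  shows "(A *\<^sub>v v) $ i = (\<Sum>j<n. A $$ (i, j) * v $ j)"
  using assms by (auto simp: scalar_prod_def lessThan_atLeast0 intro!: sum.cong)

lemma nonsingular_solvable:
  fixes A :: "real mat"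
  assumes A: "A \<in> carrier_mat n n" and "det A \<noteq> 0" and b: "b \<in> carrier_vec n"
  obtains u where "u \<in> carrier_vec n" "A *\<^sub>v u = b"
proof -
  obtain B where "B \<in> carrier_mat n n" "A * B = 1\<^sub>m n"
    using det_non_zero_imp_unit[OF A assms(2)] unfolding Units_def ring_mat_def by auto
  then have "B *\<^sub>v b \<in> carrier_vec n" "A *\<^sub>v (B *\<^sub>v b) = b"
    using A b by (auto simp flip: assoc_mult_mat_vec)
  then show thesis by (rule that)
qed

text \<open>
  A weak form of the Perron--Frobenius theorem. The set of \<open>x\<close> for which \<open>I - xQ\<close> maps some
  positive vector to a positive vector is an open initial segment of the nonnegative reals, and
  \<open>I - xQ\<close> is singular at its supremum.
\<close>

lemma nonneg_mat_eigenvalue_ge: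
  fixes Q :: "real mat"
  assumes Q: "Q \<in> carrier_mat n n"
    and nonneg: "\<And>i j. i < n \<Longrightarrow> j < n \<Longrightarrow> 0 \<le> Q $$ (i, j)"
    and w: "\<And>i. i < n \<Longrightarrow> 0 \<le> w i" "i0 < n" "0 < w i0"
    and y: "0 < y" "\<And>i. i < n \<Longrightarrow> y * w i \<le> (\<Sum>j<n. Q $$ (i, j) * w j)"
  shows "\<exists>z \<ge> y. eigenvalue Q z"
proof -
  define S where "S u i = (\<Sum>j<n. Q $$ (i, j) * u j)" for u :: "nat \<Rightarrow> real" and i
  define X where "X = {x. 0 \<le> x \<and> (\<exists>u. \<forall>i<n. 0 < u i \<and> x * S u i < u i)}"
  have mono: "0 \<le> v i" if "x \<in> X" "\<And>i. i < n \<Longrightarrow> x * S v i \<le> v i" "i < n" for x v i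
    using that semipositive_mono[where q = "\<lambda>i j. Q $$ (i, j)", OF nonneg] unfolding X_def S_def
    by blast
  have X0: "0 \<in> X"
    unfolding X_def by (auto intro!: exI[of _ "\<lambda>_. 1"])
  have X_le: "x \<le> 1 / y" if x: "x \<in> X" for x
  proof (rule ccontr)
    assume "\<not> x \<le> 1 / y"
    then have xy: "1 \<le> x * y" using y(1) by (simp add: field_simps)
    \<comment> \<open>Since x y >= 1, the vector -w meets the hypothesis of \<open>mono\<close>; its
      nonnegativity contradicts \<open>0 < w i0\<close>.\<close>
    have "x * S (\<lambda>j. - w j) i \<le> - w i" if i: "i < n" for i
    proof -
      have "1 * w i \<le> (x * y) * w i"
        using xy w(1)[OF i] by (intro mult_right_mono) auto
      also have "\<dots> \<le> x * S w i"
        using x y(2)[OF i] unfolding X_def S_def mult.assoc by (intro mult_left_mono) auto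
      finally show ?thesis by (simp add: S_def sum_negf)
    qed
    from mono[OF x this w(2)] w(3) show False by simp
  qed
  define s where "s = Sup X"
  have bdd: "bdd_above X" using X_le by (auto simp: bdd_above_def)
  have s0: "0 \<le> s" unfolding s_def by (rule cSup_upper[OF X0 bdd])
  have s_le: "s \<le> 1 / y" unfolding s_def using X0 X_le by (intro cSup_least) auto
  define B where "B = 1\<^sub>m n - s \<cdot>\<^sub>m Q"
  have B: "B \<in> carrier_mat n n" using Q by (auto simp: B_def)
  have B_vec: "B *\<^sub>v v = v - s \<cdot>\<^sub>v (Q *\<^sub>v v)" if "v \<in> carrier_vec n" for v
    unfolding B_def minus_mult_distrib_mat_vec[OF one_carrier_mat smult_carrier_mat[OF Q] that]
    using Q that by (intro eq_vecI) auto
  \<comment> \<open>Otherwise (I - s Q) u = (1, ..., 1) is solvable, and this u witnesses that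
    \<open>X\<close> extends beyond its supremum.\<close>
  have "det B = 0"
  proof (rule ccontr)
    assume "det B \<noteq> 0"
    then obtain uv where uv: "uv \<in> carrier_vec n" "B *\<^sub>v uv = vec n (\<lambda>_. 1)"
      using nonsingular_solvable[OF B, of "vec n (\<lambda>_. 1)"] by auto
    define u where "u i = uv $ i" for i
    have u_eq: "u i = 1 + s * S u i" if i: "i < n" for i
    proof -
      have "(B *\<^sub>v uv) $ i = u i - s * (Q *\<^sub>v uv) $ i"
        unfolding B_vec[OF uv(1)] u_def using uv(1) Q i by simp
      then show ?thesis
        using mult_mat_vec_index[OF Q uv(1) i] i unfolding uv(2) S_def u_def by simp
    qed
    \<comment> \<open>Moving the parameter away from \<open>s\<close> by at most
      \<open>1 / K\<close> changes its product with \<open>S u i\<close> by less than 1, which is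
      the slack in \<open>u i = 1 + s * S u i\<close>. The summand 1 keeps \<open>K\<close>
      positive.\<close>
    define K where "K = 1 + (\<Sum>i<n. \<bar>S u i\<bar>)"
    have K: "\<bar>S u i\<bar> < K" if "i < n" for i
    proof -
      have "\<bar>S u i\<bar> \<le> (\<Sum>i<n. \<bar>S u i\<bar>)" using that by (intro member_le_sum) auto
      then show ?thesis unfolding K_def by simp
    qed
    have K0: "0 < K" unfolding K_def by (intro add_pos_nonneg sum_nonneg) auto
    have "s - 1 / K < Sup X" using K0 by (simp add: s_def)
    then obtain x where x: "x \<in> X" "s - 1 / K < x" using less_cSupE X0 by blast
    then have xs: "x \<le> s" unfolding s_def by (intro cSup_upper bdd)
    have small: "t * S u i < 1" if "i < n" "0 \<le> t" "t \<le> 1 / K" for t i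
    proof -
      have "t * S u i \<le> t * \<bar>S u i\<bar>" using that by (intro mult_left_mono) auto
      also have "\<dots> \<le> 1 / K * \<bar>S u i\<bar>" using that by (intro mult_right_mono) auto
      also have "\<dots> < 1" using K[OF that(1)] K0 by (simp add: field_simps)
      finally show ?thesis .
    qed
    have u0: "0 \<le> u i" if "i < n" for i
    proof (rule mono[OF x(1) _ that])
      fix i assume i: "i < n"
      have "\<bar>(x - s) * S u i\<bar> \<le> 1 / K * K"
        unfolding abs_mult using x(2) xs K[OF i] K0 by (intro mult_mono) auto
      then have "(x - s) * S u i \<le> 1" using K0 by simp
      then show "x * S u i \<le> u i" using u_eq[OF i] by (simp add: algebra_simps)
    qed
    have "s + 1 / K \<in> X"
      unfolding X_def
    proof (intro CollectI conjI exI allI impI)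
      show "0 \<le> s + 1 / K" using s0 K0 by simp
      fix i assume i: "i < n"
      have "0 \<le> S u i" unfolding S_def using nonneg[OF i] u0 by (intro sum_nonneg) auto
      then have "0 \<le> s * S u i" using s0 by simp
      then show "0 < u i" using u_eq[OF i] by linarith
      show "(s + 1 / K) * S u i < u i"
        using small[OF i, of "1 / K"] u_eq[OF i] K0 by (simp add: distrib_right)
    qed
    then have "s + 1 / K \<le> s" unfolding s_def by (intro cSup_upper bdd)
    then show False using K0 by simp
  qed
  then obtain v where v: "v \<in> carrier_vec n" "v \<noteq> 0\<^sub>v n" "B *\<^sub>v v = 0\<^sub>v n"
    using det_0_iff_vec_prod_zero[OF B] by auto
  have vi: "v $ i = s * (Q *\<^sub>v v) $ i" if "i < n" for i
  proof -
    have "(B *\<^sub>v v) $ i = v $ i - s * (Q *\<^sub>v v) $ i"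
      unfolding B_vec[OF v(1)] using v(1) Q that by simp
    then show ?thesis using v(3) that by simp
  qed
  have "s \<noteq> 0"
  proof
    assume "s = 0"
    then have "v = 0\<^sub>v n" using v(1) vi by (intro eq_vecI) auto
    then show False using v(2) by simp
  qed
  with s0 have s: "0 < s" by simp
  have "eigenvalue Q (1 / s)"
    unfolding eigenvalue_def eigenvector_def
  proof (intro exI conjI)
    show "Q *\<^sub>v v = 1 / s \<cdot>\<^sub>v v"
      using Q v(1) vi s by (intro eq_vecI) (auto simp: field_simps)
  qed (use Q v in auto)
  moreover have "y \<le> 1 / s" using s_le s y(1) by (simp add: field_simps)
  ultimately show ?thesis by blast
qed

section \<open>Checkerboard sign patterns\<close>

text \<open>The weak inequality admits zero entries, which inverses of totally positive matrices may
  have. Indexing from 0 or from 1 gives the same parity of \<open>i + j\<close>.\<close>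

definition checkerboard :: "real mat \<Rightarrow> bool" where
  "checkerboard B \<longleftrightarrow> (\<forall>i < dim_row B. \<forall>j < dim_col B. 0 \<le> (-1) ^ (i + j) * B $$ (i, j))"

lemma checkerboard_abs:
  assumes "checkerboard B" "i < dim_row B" "j < dim_col B"
  shows "\<bar>B $$ (i, j)\<bar> = (-1) ^ (i + j) * B $$ (i, j)"
proof -
  have "0 \<le> (-1) ^ (i + j) * B $$ (i, j)" using assms by (simp add: checkerboard_def)
  moreover have "\<bar>(-1) ^ (i + j) * B $$ (i, j)\<bar> = \<bar>B $$ (i, j)\<bar>"
    by (simp add: abs_mult power_abs)
  ultimately show ?thesis by linarith
qed

lemma mult_mat_index:
  assumes "A \<in> carrier_mat n n" "B \<in> carrier_mat n n" "i < n" "j < n"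
  shows "(A * B) $$ (i, j) = (\<Sum>k<n. A $$ (i, k) * B $$ (k, j))"
  using assms by (auto simp: scalar_prod_def lessThan_atLeast0 intro!: sum.cong)

text \<open>Since (-1)^(i+j) = (-1)^(i+k) (-1)^(k+j), all terms of entry (i, j) of the product carry
  the same sign, so nothing cancels.\<close>

lemma checkerboard_mult_abs:
  assumes A: "A \<in> carrier_mat n n" "checkerboard A" and B: "B \<in> carrier_mat n n" "checkerboard B"
    and ij: "i < n" "j < n"
  shows "(-1) ^ (i + j) * (A * B) $$ (i, j) = (\<Sum>k<n. \<bar>A $$ (i, k)\<bar> * \<bar>B $$ (k, j)\<bar>)"
proof -
  have "(-1) ^ (i + j) * (a * b) = ((-1) ^ (i + k) * a) * ((-1) ^ (k + j) * b)"
    for a b :: real and k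
    by (simp add: power_add)
  then have "(-1) ^ (i + j) * (A $$ (i, k) * B $$ (k, j)) = \<bar>A $$ (i, k)\<bar> * \<bar>B $$ (k, j)\<bar>"
    if "k < n" for k
    using checkerboard_abs[OF A(2), of i k] checkerboard_abs[OF B(2), of k j] A(1) B(1) ij that
    by simp
  then show ?thesis
    unfolding mult_mat_index[OF A(1) B(1) ij] sum_distrib_left by (intro sum.cong) auto
qed

lemma checkerboard_mult:
  assumes A: "A \<in> carrier_mat n n" "checkerboard A" and B: "B \<in> carrier_mat n n" "checkerboard B"
  shows "checkerboard (A * B)"
  unfolding checkerboard_def
  using A B checkerboard_mult_abs[OF A B] by (auto intro!: sum_nonneg)

lemma abs_checkerboard_mult:
  assumes A: "A \<in> carrier_mat n n" "checkerboard A" and B: "B \<in> carrier_mat n n" "checkerboard B"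
    and ij: "i < n" "j < n"
  shows "\<bar>(A * B) $$ (i, j)\<bar> = (\<Sum>k<n. \<bar>A $$ (i, k)\<bar> * \<bar>B $$ (k, j)\<bar>)"
  using checkerboard_mult_abs[OF assms] checkerboard_abs[OF checkerboard_mult[OF A B], of i j] assms
  by simp

lemma checkerboard_transpose:
  "checkerboard A \<Longrightarrow> checkerboard A\<^sup>T"
  unfolding checkerboard_def by (metis add.commute index_transpose_mat(1,2,3))

section \<open>Small eigenvalues from checkerboard inverses\<close>

text \<open>The test vector \<open>w\<close> certifies that |B| has an eigenvalue z >= y.
  Conjugation by diag (1, -1, 1, ...) carries z over to \<open>B\<close>, and inversion turns it
  into the eigenvalue 1/z of \<open>Y\<close>.\<close>

lemma checkerboard_inverse_eigenvalue:
  assumes Y: "Y \<in> carrier_mat n n" and B: "B \<in> carrier_mat n n" "Y * B = 1\<^sub>m n"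
    and cb: "checkerboard B"
    and w: "\<And>i. i < n \<Longrightarrow> 0 \<le> w i" "i0 < n" "0 < w i0"
    and y: "0 < y" "\<And>i. i < n \<Longrightarrow> y * w i \<le> (\<Sum>j<n. \<bar>B $$ (i, j)\<bar> * w j)"
  shows "\<exists>\<nu>>0. \<nu> \<le> 1 / y \<and> eigenvalue Y \<nu>"
proof -
  define Q where "Q = abs_mat B"
  have Q: "Q \<in> carrier_mat n n" using B(1) by (simp add: Q_def abs_mat_def)
  have Q_index: "Q $$ (i, j) = \<bar>B $$ (i, j)\<bar>" if "i < n" "j < n" for i j
    using B(1) that by (simp add: Q_def abs_mat_def)
  obtain z where z: "y \<le> z" "eigenvalue Q z"
    using nonneg_mat_eigenvalue_ge[OF Q, where w = w, OF _ w y(1)] y(2) Q_index by auto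
  then have z0: "0 < z" using y(1) by simp
  from z(2) obtain g where g: "g \<in> carrier_vec n" "g \<noteq> 0\<^sub>v n" "Q *\<^sub>v g = z \<cdot>\<^sub>v g"
    using Q by (auto simp: eigenvalue_def eigenvector_def)
  \<comment> \<open>With D = diag (1, -1, 1, ...), B = D |B| D, so h = D g is an eigenvector of
    \<open>B\<close> whenever g is one of |B|.\<close>
  define h where "h = vec n (\<lambda>i. (-1) ^ i * g $ i)"
  have h: "h \<in> carrier_vec n" by (simp add: h_def)
  have Bh: "B *\<^sub>v h = z \<cdot>\<^sub>v h"
  proof (rule eq_vecI)
    fix i assume "i < dim_vec (z \<cdot>\<^sub>v h)"
    then have i: "i < n" using h by simp
    have "(B *\<^sub>v h) $ i = (\<Sum>j<n. B $$ (i, j) * h $ j)"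
      by (rule mult_mat_vec_index[OF B(1) h i])
    also have "\<dots> = (\<Sum>j<n. (-1) ^ i * (Q $$ (i, j) * g $ j))"
      using i checkerboard_abs[OF cb, of i] B(1)
      by (intro sum.cong) (auto simp: Q_index h_def power_add)
    also have "\<dots> = (-1) ^ i * (Q *\<^sub>v g) $ i"
      by (simp only: sum_distrib_left mult_mat_vec_index[OF Q g(1) i])
    also have "\<dots> = (z \<cdot>\<^sub>v h) $ i"
      using i g by (simp add: h_def)
    finally show "(B *\<^sub>v h) $ i = (z \<cdot>\<^sub>v h) $ i" .
  qed (use B h in auto)
  have "h = Y *\<^sub>v (B *\<^sub>v h)"
    using Y B h by (simp flip: assoc_mult_mat_vec)
  then have hY: "h = z \<cdot>\<^sub>v (Y *\<^sub>v h)"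
    unfolding Bh using Y h by (simp add: mult_mat_vec)
  have "eigenvalue Y (1 / z)"
    unfolding eigenvalue_def eigenvector_def
  proof (intro exI conjI)
    show "h \<noteq> 0\<^sub>v (dim_row Y)"
    proof
      assume h0: "h = 0\<^sub>v (dim_row Y)"
      have "g $ i = 0" if "i < n" for i
        using arg_cong[OF h0, of "\<lambda>v. v $ i"] that Y by (simp add: h_def)
      then have "g = 0\<^sub>v n" using g(1) by (intro eq_vecI) auto
      then show False using g(2) by simp
    qed
    show "Y *\<^sub>v h = 1 / z \<cdot>\<^sub>v h"
      using arg_cong[OF hY, of "\<lambda>v. 1 / z \<cdot>\<^sub>v v"] z0 by (simp add: smult_smult_assoc)
  qed (use Y h in auto)
  moreover have "1 / z \<le> 1 / y" using z y(1) by (simp add: frac_le)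
  ultimately show ?thesis using z0 by (intro exI[of _ "1 / z"]) auto
qed

text \<open>For an eigenvector v of \<open>X\<close>, the triangle inequality in v = \<mu> P v gives
  (1/\<mu>) |v| <= |P| |v| <= |B| |v|. Hence |v| serves as the test vector with y = 1/\<mu>.\<close>

lemma inverse_dominated_eigenvalue_le:
  assumes X: "X \<in> carrier_mat n n" and P: "P \<in> carrier_mat n n" "P * X = 1\<^sub>m n"
    and Y: "Y \<in> carrier_mat n n" and B: "B \<in> carrier_mat n n" "Y * B = 1\<^sub>m n"
    and cb: "checkerboard B"
    and le: "\<And>i j. i < n \<Longrightarrow> j < n \<Longrightarrow> \<bar>P $$ (i, j)\<bar> \<le> \<bar>B $$ (i, j)\<bar>"
    and ev: "eigenvalue X \<mu>" and \<mu>: "0 < \<mu>"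
  shows "\<exists>\<nu>>0. \<nu> \<le> \<mu> \<and> eigenvalue Y \<nu>"
proof -
  from ev obtain v where v: "v \<in> carrier_vec n" "v \<noteq> 0\<^sub>v n" "X *\<^sub>v v = \<mu> \<cdot>\<^sub>v v"
    using X by (auto simp: eigenvalue_def eigenvector_def)
  obtain i0 where i0: "i0 < n" "v $ i0 \<noteq> 0"
    using v(1,2) by (metis carrier_vecD eq_vecI index_zero_vec)
  have "v = P *\<^sub>v (X *\<^sub>v v)"
    using X P v(1) by (simp flip: assoc_mult_mat_vec)
  then have vP: "v = \<mu> \<cdot>\<^sub>v (P *\<^sub>v v)"
    unfolding v(3) using P v(1) by (simp add: mult_mat_vec)
  have "1 / \<mu> * \<bar>v $ i\<bar> \<le> (\<Sum>j<n. \<bar>B $$ (i, j)\<bar> * \<bar>v $ j\<bar>)" if i: "i < n" for i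
  proof -
    have "v $ i = \<mu> * (P *\<^sub>v v) $ i"
      using arg_cong[OF vP, of "\<lambda>v. v $ i"] P i by simp
    then have "1 / \<mu> * \<bar>v $ i\<bar> = \<bar>\<Sum>j<n. P $$ (i, j) * v $ j\<bar>"
      using \<mu> by (simp add: abs_mult mult_mat_vec_index[OF P(1) v(1) i])
    also have "\<dots> \<le> (\<Sum>j<n. \<bar>P $$ (i, j)\<bar> * \<bar>v $ j\<bar>)"
      by (rule order_trans[OF sum_abs]) (simp add: abs_mult)
    also have "\<dots> \<le> (\<Sum>j<n. \<bar>B $$ (i, j)\<bar> * \<bar>v $ j\<bar>)"
      using le[OF i] by (intro sum_mono mult_right_mono) auto
    finally show ?thesis .
  qed
  from checkerboard_inverse_eigenvalue[OF Y B cb _ i0(1) _ _ this] i0 \<mu>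
  show ?thesis by simp
qed

text \<open>This makes the sets inside \<open>min_eigenvalue\<close> and
  \<open>min_singular_value\<close> nonempty, so that their \<open>Min\<close> is attained. The test
  vector is constant 1, with y the least absolute row sum of \<open>B\<close>; an invertible matrix
  has no zero row, so y is positive.\<close>

lemma checkerboard_inverse_has_eigenvalue:
  assumes Y: "Y \<in> carrier_mat n n" and B: "B \<in> carrier_mat n n" "Y * B = 1\<^sub>m n" "B * Y = 1\<^sub>m n"
    and cb: "checkerboard B" and n: "0 < n"
  shows "\<exists>\<nu>. eigenvalue Y \<nu>"
proof -
  define r where "r i = (\<Sum>j<n. \<bar>B $$ (i, j)\<bar>)" for i
  have r: "0 < r i" if i: "i < n" for i
  proof -
    have "(\<Sum>k<n. B $$ (i, k) * Y $$ (k, i)) = 1"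
      using mult_mat_index[OF B(1) Y i i] B(3) i by simp
    then have "\<exists>k\<in>{..<n}. B $$ (i, k) * Y $$ (k, i) \<noteq> 0"
      by (metis (no_types, lifting) sum.neutral zero_neq_one)
    then obtain k where "k < n" "B $$ (i, k) \<noteq> 0" by auto
    then show ?thesis unfolding r_def by (intro sum_pos2[of _ k]) auto
  qed
  define y where "y = Min (r ` {..<n})"
  have "y \<in> r ` {..<n}" unfolding y_def using n by (intro Min_in) auto
  then have y: "0 < y" using r by auto
  have "y \<le> r i" if "i < n" for i unfolding y_def using that by (intro Min_le) auto
  then show ?thesis
    using checkerboard_inverse_eigenvalue[OF Y B(1,2) cb _ n _ y, of "\<lambda>_. 1"] by (auto simp: r_def)
qed


section \<open>Minors, cofactors and positivity of the eigenvalues\<close>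

text \<open>Minors are indexed by increasing maps instead of sets: deleting a row and a column is
  then composition with \<open>insert_index\<close>, and repeated selections compose.\<close>

definition select_mat :: "real mat \<Rightarrow> nat \<Rightarrow> (nat \<Rightarrow> nat) \<Rightarrow> (nat \<Rightarrow> nat) \<Rightarrow> real mat" where
  "select_mat M k f g = mat k k (\<lambda>(a, b). M $$ (f a, g b))"

lemma select_mat_carrier [simp]: "select_mat M k f g \<in> carrier_mat k k"
  by (simp add: select_mat_def)

text \<open>Exactly \<open>a\<close> elements of the image lie below \<open>f a\<close>, so
  \<open>pick\<close> enumerates the image in the order of \<open>f\<close>. This links
  \<open>submatrix\<close>, which takes sets, to \<open>select_mat\<close>.\<close>

lemma pick_strict_mono_image:
  assumes f: "strict_mono_on {..<k} f" and a: "a < k"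
  shows "pick (f ` {..<k}) a = f a"
proof -
  have lt: "f b < f a \<longleftrightarrow> b < a" if "b < k" for b
    using strict_mono_on_less[OF f] a that by auto
  have "{x \<in> f ` {..<k}. x < f a} = f ` {..<a}"
    using a lt by (auto intro!: imageI)
  moreover have "inj_on f {..<a}"
    using strict_mono_on_imp_inj_on[OF f] a by (auto intro: inj_on_subset)
  ultimately have "card {x \<in> f ` {..<k}. x < f a} = a" by (simp add: card_image)
  then show ?thesis using pick_card_in_set[of "f a" "f ` {..<k}"] a by auto
qed

lemma totally_positive_select:
  assumes M: "M \<in> carrier_mat n n" and tp: "totally_positive M"
    and f: "strict_mono_on {..<k} f" "f ` {..<k} \<subseteq> {..<n}"
    and g: "strict_mono_on {..<k} g" "g ` {..<k} \<subseteq> {..<n}"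
  shows "0 \<le> det (select_mat M k f g)"
proof -
  have card: "card (f ` {..<k}) = k" "card (g ` {..<k}) = k"
    using strict_mono_on_imp_inj_on[OF f(1)] strict_mono_on_imp_inj_on[OF g(1)]
    by (simp_all add: card_image)
  have "{i. i < n \<and> i \<in> f ` {..<k}} = f ` {..<k}" "{i. i < n \<and> i \<in> g ` {..<k}} = g ` {..<k}"
    using f(2) g(2) by auto
  then have "submatrix M (f ` {..<k}) (g ` {..<k}) = select_mat M k f g"
    unfolding submatrix_def select_mat_def using M card
    by (intro eq_matI) (auto simp: pick_strict_mono_image[OF f(1)] pick_strict_mono_image[OF g(1)])
  then show ?thesis
    using tp M f(2) g(2) card unfolding totally_positive_def by (metis carrier_matD)
qed

lemma mat_delete_select:
  assumes "M \<in> carrier_mat n n"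
  shows "mat_delete M i j = select_mat M (n - 1) (insert_index i) (insert_index j)"
  using assms by (intro eq_matI) (auto simp: mat_delete_def select_mat_def insert_index_def)

lemma select_mat_select:
  assumes "f' ` {..<k} \<subseteq> {..<m}" "g' ` {..<k} \<subseteq> {..<m}"
  shows "select_mat (select_mat M m f g) k f' g' = select_mat M k (f \<circ> f') (g \<circ> g')"
  using assms by (intro eq_matI) (auto simp: select_mat_def image_subset_iff)

lemma insert_index_strict_mono: "strict_mono_on S (insert_index i)"
  by (auto simp: strict_mono_on_def insert_index_def)

lemma insert_index_image:
  assumes "i < n"
  shows "insert_index i ` {..<n - 1} \<subseteq> {..<n}"
  using assms by (auto simp: insert_index_def)

lemma totally_positive_det_pos:
  assumes M: "M \<in> carrier_mat n n" and tp: "totally_positive M"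
    and N: "N \<in> carrier_mat n n" "M * N = 1\<^sub>m n"
  shows "0 < det M"
proof -
  have "select_mat M n id id = M"
    using M by (intro eq_matI) (auto simp: select_mat_def)
  then have "0 \<le> det M"
    using totally_positive_select[OF M tp, of n id id] by (simp add: strict_mono_on_def)
  moreover have "det M * det N = 1"
    using det_mult[OF M N(1)] N(2) by simp
  ultimately show ?thesis by (cases "det M = 0") auto
qed

lemma totally_positive_nonneg:
  assumes M: "M \<in> carrier_mat n n" and tp: "totally_positive M" and ij: "i < n" "j < n"
  shows "0 \<le> M $$ (i, j)"
proof -
  have "0 \<le> det (select_mat M 1 (\<lambda>_. i) (\<lambda>_. j))"
    using ij by (intro totally_positive_select[OF M tp]) (auto simp: strict_mono_on_def)
  then show ?thesis by (simp add: det_single select_mat_def)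
qed

text \<open>Multiplying M adj(M) = det(M) I by \<open>N\<close> on the left gives adj(M) = det(M) N.
  Entry (i, j) of \<open>N\<close> is thus the (j, i) cofactor over a positive determinant, and the
  factor (-1)^(i+j) turns that cofactor into a minor of \<open>M\<close>.\<close>

lemma totally_positive_inverse_checkerboard:
  assumes M: "M \<in> carrier_mat n n" and tp: "totally_positive M"
    and N: "N \<in> carrier_mat n n" "M * N = 1\<^sub>m n" "N * M = 1\<^sub>m n"
  shows "checkerboard N"
proof -
  note det = totally_positive_det_pos[OF M tp N(1,2)]
  note adj = adj_mat[OF M]
  have "adj_mat M = N * (M * adj_mat M)"
    using M N adj(1) by (simp flip: assoc_mult_mat)
  then have adj_eq: "adj_mat M = det M \<cdot>\<^sub>m N"
    unfolding adj(2) using N(1) by (simp add: mult_smult_distrib[OF N(1) one_carrier_mat])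
  have "0 \<le> (-1) ^ (i + j) * N $$ (i, j)" if ij: "i < n" "j < n" for i j
  proof -
    have "det M * N $$ (i, j) = cofactor M j i"
      using arg_cong[OF adj_eq, of "\<lambda>A. A $$ (i, j)"] ij M N(1) by (simp add: adj_mat_def)
    then have "det M * ((-1) ^ (i + j) * N $$ (i, j)) = (-1) ^ (i + j) * cofactor M j i"
      by (simp add: ac_simps)
    also have "\<dots> = det (mat_delete M j i)"
      by (simp add: cofactor_def add.commute flip: mult.assoc power_add)
    also have "0 \<le> \<dots>"
      unfolding mat_delete_select[OF M] using ij
      by (intro totally_positive_select[OF M tp] insert_index_strict_mono insert_index_image)
    finally show ?thesis using det by (simp add: zero_le_mult_iff)
  qed
  then show ?thesis using N(1) by (simp add: checkerboard_def)
qed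

text \<open>
  \<open>det (xI + N)\<close> is nondecreasing for \<open>x \<ge> 0\<close>: its derivative is the sum of the same functions
  for the principal submatrices of order one less.
\<close>

lemma totally_positive_char_poly_ge:
  assumes M: "M \<in> carrier_mat n n" and tp: "totally_positive M"
    and "strict_mono_on {..<k} f" "f ` {..<k} \<subseteq> {..<n}" "0 \<le> x"
  shows "det (select_mat M k f f) \<le> poly (char_poly (- select_mat M k f f)) x"
  using assms(3-5)
proof (induction k arbitrary: f x)
  \<comment> \<open>Both sides are 1: an empty determinant and a monic polynomial of degree
    0.\<close>
  case 0
  have "select_mat M 0 f f \<in> carrier_mat 0 0" by simp
  then show ?case
    using degree_monic_char_poly[of "- select_mat M 0 f f" 0]
    by (auto simp: det_dim_zero elim: degree_eq_zeroE)
next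
  case (Suc k)
  define N where "N = select_mat M (Suc k) f f"
  have N: "N \<in> carrier_mat (Suc k) (Suc k)" by (simp add: N_def)
  then have uN: "- N \<in> carrier_mat (Suc k) (Suc k)" by simp
  let ?p = "char_poly (- N)"
  have deriv: "0 \<le> poly (pderiv ?p) t" if t: "0 \<le> t" for t
    unfolding pderiv_char_poly[OF uN] poly_sum
  proof (intro sum_nonneg)
    fix i assume "i \<in> {..<Suc k}"
    then have i: "i < Suc k" by simp
    \<comment> \<open>Composing with \<open>insert_index i\<close> exhibits the reduced matrix as a
      principal submatrix of \<open>M\<close> itself, so the induction hypothesis applies and total
      positivity bounds the resulting minor.\<close>
    define h where "h = f \<circ> insert_index i"
    have img: "insert_index i ` {..<k} \<subseteq> {..<Suc k}"
      using insert_index_image[OF i] by simp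
    have h: "strict_mono_on {..<k} h" "h ` {..<k} \<subseteq> {..<n}"
      using Suc.prems(1,2) img insert_index_strict_mono[of "{..<k}" i]
      by (auto simp: h_def strict_mono_on_def image_subset_iff)
    have "mat_delete (- N) i i = - mat_delete N i i"
      using N by (intro eq_matI) (auto simp: mat_delete_def)
    also have "mat_delete N i i = select_mat M k h h"
      unfolding mat_delete_select[OF N] h_def using select_mat_select[OF img img] by (simp add: N_def)
    finally have "poly (char_poly (mat_delete (- N) i i)) t = poly (char_poly (- select_mat M k h h)) t"
      by simp
    also have "\<dots> \<ge> det (select_mat M k h h)"
      by (rule Suc.IH[OF h t])
    finally show "0 \<le> poly (char_poly (mat_delete (- N) i i)) t"
      using totally_positive_select[OF M tp h h] by linarith
  qed
  \<comment> \<open>The characteristic polynomial of -N at x is det(xI + N), hence the minus sign;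
    its value at 0 is det N, and monotonicity carries the bound from 0 to x.\<close>
  have "det N = poly ?p 0"
    unfolding char_poly_matrix[OF uN]
    by (rule arg_cong[of _ _ det]) (use N in \<open>auto intro!: eq_matI simp: char_matrix_def\<close>)
  also have "\<dots> \<le> poly ?p x"
    using deriv poly_DERIV[of ?p] Suc.prems(3)
    by (intro DERIV_nonneg_imp_nondecreasing[of 0 x "poly ?p"]) blast+
  finally show ?case by (simp add: N_def)
qed

text \<open>For \<mu> <= 0, the matrix M - \<mu> I = (-\<mu>) I + M has determinant at least det M >
  0, so \<mu> cannot be an eigenvalue.\<close>

lemma totally_positive_eigenvalue_pos:
  assumes M: "M \<in> carrier_mat n n" and tp: "totally_positive M"
    and N: "N \<in> carrier_mat n n" "M * N = 1\<^sub>m n"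
    and ev: "eigenvalue M \<mu>"
  shows "0 < \<mu>"
proof (rule ccontr)
  assume "\<not> 0 < \<mu>"
  then have "0 \<le> - \<mu>" by simp
  moreover have "select_mat M n id id = M"
    using M by (intro eq_matI) (auto simp: select_mat_def)
  ultimately have "det M \<le> poly (char_poly (- M)) (- \<mu>)"
    using totally_positive_char_poly_ge[OF M tp, of n id "- \<mu>"] by (simp add: strict_mono_on_def)
  then have "poly (char_poly (- M)) (- \<mu>) \<noteq> 0"
    using totally_positive_det_pos[OF M tp N] by simp
  then have "\<not> eigenvalue (- M) (- \<mu>)"
    using M by (subst eigenvalue_root_char_poly[of _ n]) auto
  moreover from ev obtain v where "v \<in> carrier_vec n" "v \<noteq> 0\<^sub>v n" "M *\<^sub>v v = \<mu> \<cdot>\<^sub>v v"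
    using M by (auto simp: eigenvalue_def eigenvector_def)
  then have "eigenvalue (- M) (- \<mu>)"
    unfolding eigenvalue_def eigenvector_def using M
    by (intro exI[of _ v]) (auto intro!: eq_vecI)
  ultimately show False by simp
qed


section \<open>Comparison of minimal eigenvalues and minimal singular values\<close>

lemma finite_eigenvalues:
  assumes "X \<in> carrier_mat n n"
  shows "finite {x. eigenvalue (X :: real mat) x}"
proof -
  have "char_poly X \<noteq> 0"
    using degree_monic_char_poly[OF assms] by auto
  then show ?thesis
    unfolding eigenvalue_root_char_poly[OF assms] by (rule poly_roots_finite)
qed

text \<open>The minimum for \<open>X\<close> is attained, so the reciprocal comparison yields an
  eigenvalue of \<open>Y\<close> below it; that eigenvalue bounds the minimum for \<open>Y\<close>
  from above.\<close>

lemma min_eigenvalue_mono: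
  assumes X: "X \<in> carrier_mat n n" and P: "P \<in> carrier_mat n n" "X * P = 1\<^sub>m n" "P * X = 1\<^sub>m n"
    and Y: "Y \<in> carrier_mat n n" and B: "B \<in> carrier_mat n n" "Y * B = 1\<^sub>m n"
    and cb: "checkerboard P" "checkerboard B"
    and le: "\<And>i j. i < n \<Longrightarrow> j < n \<Longrightarrow> \<bar>P $$ (i, j)\<bar> \<le> \<bar>B $$ (i, j)\<bar>"
    and n: "0 < n" and pos: "\<And>\<mu>. eigenvalue X \<mu> \<Longrightarrow> 0 < \<mu>"
  shows "min_eigenvalue Y \<le> min_eigenvalue X"
proof -
  have "{x. eigenvalue X x} \<noteq> {}"
    using checkerboard_inverse_has_eigenvalue[OF X P cb(1) n] by auto
  then have ev: "eigenvalue X (min_eigenvalue X)"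
    unfolding min_eigenvalue_def using Min_in[OF finite_eigenvalues[OF X]] by auto
  then obtain \<nu> where "\<nu> \<le> min_eigenvalue X" "eigenvalue Y \<nu>"
    using inverse_dominated_eigenvalue_le[OF X P(1,3) Y B cb(2) le ev pos[OF ev]] by auto
  then show ?thesis
    unfolding min_eigenvalue_def[of Y] using Min_le[OF finite_eigenvalues[OF Y], of \<nu>] by auto
qed

lemma nonzero_vec_index:
  assumes "v \<in> carrier_vec n - {0\<^sub>v n}"
  obtains i where "i < n" "v $ i \<noteq> 0"
  using assms by (metis DiffE carrier_vecD eq_vecI index_zero_vec insertI1)

lemma scalar_prod_self_pos:
  fixes v :: "real vec"
  assumes v: "v \<in> carrier_vec n" "v \<noteq> 0\<^sub>v n"
  shows "0 < v \<bullet> v"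
proof -
  obtain i where "i < n" "v $ i \<noteq> 0" using nonzero_vec_index v by blast
  then show ?thesis
    unfolding scalar_prod_def using v(1) by (intro sum_pos2[of _ i]) (auto simp: zero_less_mult_iff)
qed

lemma transpose_mult_one:
  fixes A B :: "'a :: comm_semiring_1 mat"
  assumes "A \<in> carrier_mat n n" "B \<in> carrier_mat n n" "A * B = 1\<^sub>m n"
  shows "B\<^sup>T * A\<^sup>T = 1\<^sub>m n"
  using transpose_mult[OF assms(1,2)] assms(3) by simp

lemma gram_inverse:
  fixes X P :: "real mat"
  assumes X: "X \<in> carrier_mat n n" and P: "P \<in> carrier_mat n n" "X * P = 1\<^sub>m n" "P * X = 1\<^sub>m n"
  shows "(X\<^sup>T * X) * (P * P\<^sup>T) = 1\<^sub>m n" "(P * P\<^sup>T) * (X\<^sup>T * X) = 1\<^sub>m n"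
proof -
  have T: "X\<^sup>T * P\<^sup>T = 1\<^sub>m n" "P\<^sup>T * X\<^sup>T = 1\<^sub>m n"
    using transpose_mult_one X P by blast+
  have "(X\<^sup>T * X) * (P * P\<^sup>T) = X\<^sup>T * ((X * P) * P\<^sup>T)"
    using X P(1) by (simp add: assoc_mult_mat[of _ n n _ n _ n])
  also have "\<dots> = 1\<^sub>m n" using P T by simp
  finally show "(X\<^sup>T * X) * (P * P\<^sup>T) = 1\<^sub>m n" .
  have "(P * P\<^sup>T) * (X\<^sup>T * X) = P * ((P\<^sup>T * X\<^sup>T) * X)"
    using X P(1) by (simp add: assoc_mult_mat[of _ n n _ n _ n])
  also have "\<dots> = 1\<^sub>m n" using X P T by simp
  finally show "(P * P\<^sup>T) * (X\<^sup>T * X) = 1\<^sub>m n" .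
qed

text \<open>For an eigenvector v, \<mu> (v . v) = (X v) . (X v), and X v is nonzero because
  \<open>X\<close> has a left inverse.\<close>

lemma gram_eigenvalue_pos:
  fixes X P :: "real mat"
  assumes X: "X \<in> carrier_mat n n" and P: "P \<in> carrier_mat n n" "P * X = 1\<^sub>m n"
    and ev: "eigenvalue (X\<^sup>T * X) \<mu>"
  shows "0 < \<mu>"
proof -
  obtain v where v: "v \<in> carrier_vec n" "v \<noteq> 0\<^sub>v n" "(X\<^sup>T * X) *\<^sub>v v = \<mu> \<cdot>\<^sub>v v"
    using ev X by (auto simp: eigenvalue_def eigenvector_def)
  have Xv: "X *\<^sub>v v \<in> carrier_vec n" using X v by simp
  have "X *\<^sub>v v \<noteq> 0\<^sub>v n"
  proof
    assume "X *\<^sub>v v = 0\<^sub>v n"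
    then have "P *\<^sub>v (X *\<^sub>v v) = 0\<^sub>v n" using P by auto
    then show False using v P X by (simp flip: assoc_mult_mat_vec)
  qed
  then have pos: "0 < (X *\<^sub>v v) \<bullet> (X *\<^sub>v v)" "0 < v \<bullet> v"
    using scalar_prod_self_pos Xv v(1,2) by blast+
  have "\<mu> * (v \<bullet> v) = ((X\<^sup>T * X) *\<^sub>v v) \<bullet> v"
    unfolding v(3) using v(1) by simp
  also have "\<dots> = (X\<^sup>T *\<^sub>v (X *\<^sub>v v)) \<bullet> v"
    using X v(1) by (simp add: assoc_mult_mat_vec[of _ n n _ n])
  also have "\<dots> = (X *\<^sub>v v) \<bullet> (X *\<^sub>v v)"
    using transpose_vec_mult_scalar[OF X v(1) Xv] X v(1) Xv
    by (simp add: comm_scalar_prod[of _ n])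
  finally show ?thesis using pos by (metis zero_less_mult_pos2)
qed

text \<open>The Gram matrices have inverses P P^T and B B^T. These are again checkerboard, and their
  absolute entries are sums of products of absolute entries, so domination passes from P, B to them
  and the eigenvalue comparison applies.\<close>

lemma min_singular_value_mono:
  assumes X: "X \<in> carrier_mat n n" and P: "P \<in> carrier_mat n n" "X * P = 1\<^sub>m n" "P * X = 1\<^sub>m n"
    and Y: "Y \<in> carrier_mat n n" and B: "B \<in> carrier_mat n n" "Y * B = 1\<^sub>m n" "B * Y = 1\<^sub>m n"
    and cb: "checkerboard P" "checkerboard B"
    and le: "\<And>i j. i < n \<Longrightarrow> j < n \<Longrightarrow> \<bar>P $$ (i, j)\<bar> \<le> \<bar>B $$ (i, j)\<bar>"
    and n: "0 < n"
  shows "min_singular_value Y \<le> min_singular_value X"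
proof -
  have G: "X\<^sup>T * X \<in> carrier_mat n n" "P * P\<^sup>T \<in> carrier_mat n n"
    "Y\<^sup>T * Y \<in> carrier_mat n n" "B * B\<^sup>T \<in> carrier_mat n n"
    using X P Y B by auto
  have cbT: "checkerboard P\<^sup>T" "checkerboard B\<^sup>T"
    using cb checkerboard_transpose by auto
  have cbG: "checkerboard (P * P\<^sup>T)" "checkerboard (B * B\<^sup>T)"
    using cb cbT P(1) B(1) by (auto intro!: checkerboard_mult)
  have leG: "\<bar>(P * P\<^sup>T) $$ (i, j)\<bar> \<le> \<bar>(B * B\<^sup>T) $$ (i, j)\<bar>" if "i < n" "j < n" for i j
  proof -
    have "\<bar>(P * P\<^sup>T) $$ (i, j)\<bar> = (\<Sum>k<n. \<bar>P $$ (i, k)\<bar> * \<bar>P\<^sup>T $$ (k, j)\<bar>)"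
      using P cb cbT that by (intro abs_checkerboard_mult) auto
    also have "\<dots> \<le> (\<Sum>k<n. \<bar>B $$ (i, k)\<bar> * \<bar>B\<^sup>T $$ (k, j)\<bar>)"
      using P(1) B(1) le that by (intro sum_mono mult_mono) auto
    also have "\<dots> = \<bar>(B * B\<^sup>T) $$ (i, j)\<bar>"
      using B cb cbT that by (intro abs_checkerboard_mult[symmetric]) auto
    finally show ?thesis .
  qed
  note gX = gram_inverse[OF X P] and gY = gram_inverse[OF Y B]
  have sv: "{sqrt x | x. eigenvalue Z x} = sqrt ` {x. eigenvalue Z x}" for Z by auto
  have fin: "finite (sqrt ` {x. eigenvalue (X\<^sup>T * X) x})" "finite (sqrt ` {x. eigenvalue (Y\<^sup>T * Y) x})"
    using finite_eigenvalues[OF G(1)] finite_eigenvalues[OF G(3)] by auto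
  have "sqrt ` {x. eigenvalue (X\<^sup>T * X) x} \<noteq> {}"
    using checkerboard_inverse_has_eigenvalue[OF G(1,2) gX cbG(1) n] by auto
  from Min_in[OF fin(1) this] obtain \<mu>
    where \<mu>: "eigenvalue (X\<^sup>T * X) \<mu>" "min_singular_value X = sqrt \<mu>"
    unfolding min_singular_value_def sv by auto
  obtain \<nu> where \<nu>: "\<nu> \<le> \<mu>" "eigenvalue (Y\<^sup>T * Y) \<nu>"
    using inverse_dominated_eigenvalue_le[OF G(1,2) gX(2) G(3,4) gY(1) cbG(2) leG \<mu>(1)
      gram_eigenvalue_pos[OF X P(1,3) \<mu>(1)]] by auto
  have "min_singular_value Y \<le> sqrt \<nu>"
    unfolding min_singular_value_def sv using \<nu>(2) by (intro Min_le[OF fin(2)]) auto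
  then show ?thesis unfolding \<mu>(2) using real_sqrt_le_mono[OF \<nu>(1)] by (rule order_trans)
qed

section \<open>Induced norms, inverses and condition numbers\<close>

lemma vec_norm_inf_ge: "i < dim_vec v \<Longrightarrow> \<bar>v $ i\<bar> \<le> vec_norm_inf v"
  unfolding vec_norm_inf_def by (intro Min_le Max_ge) auto

lemma vec_norm_inf_le:
  "0 < dim_vec v \<Longrightarrow> (\<And>i. i < dim_vec v \<Longrightarrow> \<bar>v $ i\<bar> \<le> c) \<Longrightarrow> vec_norm_inf v \<le> c"
  unfolding vec_norm_inf_def by (subst Max_le_iff) auto

lemma induced_norm_inf:
  assumes B: "B \<in> carrier_mat n n" and n: "0 < n"
  shows "induced_norm vec_norm_inf B = (MAX i\<in>{..<n}. \<Sum>j<n. \<bar>B $$ (i, j)\<bar>)" (is "_ = Max (?r ` _)")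
  unfolding induced_norm_def
proof (rule cSup_eq_maximum)
  have "Max (?r ` {..<n}) \<in> ?r ` {..<n}" using n by (intro Max_in) auto
  then obtain k where k: "k < n" "Max (?r ` {..<n}) = ?r k" by auto
  \<comment> \<open>The sign vector of the maximal row \<open>k\<close> has norm 1 and turns entry
    \<open>k\<close> of B v into the absolute row sum. Zero entries get sign 1.\<close>
  define v where "v = vec n (\<lambda>j. if B $$ (k, j) < 0 then -1 else 1 :: real)"
  have v: "v \<in> carrier_vec n" by (simp add: v_def)
  have "v $ 0 \<noteq> 0" using n by (simp add: v_def)
  then have v0: "v \<noteq> 0\<^sub>v n" using n by auto
  have "vec_norm_inf v \<le> 1" using n by (intro vec_norm_inf_le) (auto simp: v_def)
  moreover have "1 \<le> vec_norm_inf v" using vec_norm_inf_ge[of 0 v] n by (auto simp: v_def split: if_splits)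
  ultimately have nv: "vec_norm_inf v = 1" by simp
  have le: "\<bar>(B *\<^sub>v v) $ i\<bar> \<le> ?r i" if i: "i < n" for i
    unfolding mult_mat_vec_index[OF B v i]
    by (rule order_trans[OF sum_abs]) (auto intro!: sum_mono simp: v_def abs_mult)
  have "(B *\<^sub>v v) $ k = ?r k"
    unfolding mult_mat_vec_index[OF B v k(1)] by (intro sum.cong) (auto simp: v_def)
  then have "?r k \<le> vec_norm_inf (B *\<^sub>v v)"
    using vec_norm_inf_ge[of k "B *\<^sub>v v"] B k(1) by simp
  moreover have "vec_norm_inf (B *\<^sub>v v) \<le> ?r k"
  proof (rule vec_norm_inf_le)
    fix i assume "i < dim_vec (B *\<^sub>v v)"
    then have i: "i < n" using B by simp
    have "?r i \<le> Max (?r ` {..<n})" using i by (intro Max_ge) auto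
    then show "\<bar>(B *\<^sub>v v) $ i\<bar> \<le> ?r k" using le[OF i] k(2) by simp
  qed (use B n in auto)
  ultimately have "vec_norm_inf (B *\<^sub>v v) / vec_norm_inf v = Max (?r ` {..<n})"
    using nv k(2) by simp
  then show "Max (?r ` {..<n}) \<in> (\<lambda>v. vec_norm_inf (B *\<^sub>v v) / vec_norm_inf v) `
      (carrier_vec (dim_col B) - {0\<^sub>v (dim_col B)})"
    using v v0 B by (intro image_eqI[of _ _ v]) auto
next
  fix x assume "x \<in> (\<lambda>v. vec_norm_inf (B *\<^sub>v v) / vec_norm_inf v) `
      (carrier_vec (dim_col B) - {0\<^sub>v (dim_col B)})"
  then obtain v where v: "v \<in> carrier_vec n - {0\<^sub>v n}" "x = vec_norm_inf (B *\<^sub>v v) / vec_norm_inf v"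
    using B by auto
  then have vc: "v \<in> carrier_vec n" by simp
  obtain i0 where "i0 < n" "v $ i0 \<noteq> 0" by (rule nonzero_vec_index[OF v(1)])
  then have pos: "0 < vec_norm_inf v" using vec_norm_inf_ge[of i0 v] vc by auto
  have "vec_norm_inf (B *\<^sub>v v) \<le> Max (?r ` {..<n}) * vec_norm_inf v"
  proof (rule vec_norm_inf_le)
    fix i assume "i < dim_vec (B *\<^sub>v v)"
    then have i: "i < n" using B by simp
    have "\<bar>(B *\<^sub>v v) $ i\<bar> \<le> (\<Sum>j<n. \<bar>B $$ (i, j)\<bar> * \<bar>v $ j\<bar>)"
      unfolding mult_mat_vec_index[OF B vc i] by (rule order_trans[OF sum_abs]) (simp add: abs_mult)
    also have "\<dots> \<le> (\<Sum>j<n. \<bar>B $$ (i, j)\<bar> * vec_norm_inf v)"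
      using vec_norm_inf_ge[of _ v] vc by (intro sum_mono mult_left_mono) auto
    also have "\<dots> = ?r i * vec_norm_inf v" by (simp add: sum_distrib_right)
    also have "\<dots> \<le> Max (?r ` {..<n}) * vec_norm_inf v"
      using pos i by (intro mult_right_mono Max_ge) auto
    finally show "\<bar>(B *\<^sub>v v) $ i\<bar> \<le> Max (?r ` {..<n}) * vec_norm_inf v" .
  qed (use B n in auto)
  then show "x \<le> Max (?r ` {..<n})" unfolding v(2) using pos by (simp add: pos_divide_le_eq)
qed

lemma induced_norm_1:
  assumes B: "B \<in> carrier_mat n n" and n: "0 < n"
  shows "induced_norm vec_norm_1 B = (MAX j\<in>{..<n}. \<Sum>i<n. \<bar>B $$ (i, j)\<bar>)" (is "_ = Max (?c ` _)")
  unfolding induced_norm_def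
proof (rule cSup_eq_maximum)
  have "Max (?c ` {..<n}) \<in> ?c ` {..<n}" using n by (intro Max_in) auto
  then obtain k where k: "k < n" "Max (?c ` {..<n}) = ?c k" by auto
  \<comment> \<open>The unit vector that selects the column with the largest absolute sum attains
    the supremum.\<close>
  define v :: "real vec" where "v = unit_vec n k"
  have v: "v \<in> carrier_vec n" by (simp add: v_def)
  have "v $ k \<noteq> 0" using k by (simp add: v_def)
  then have v0: "v \<noteq> 0\<^sub>v n" using k by auto
  have "vec_norm_1 v = (\<Sum>i<n. if i = k then 1 else 0)"
    unfolding vec_norm_1_def using k(1) by (intro sum.cong) (auto simp: v_def)
  then have nv: "vec_norm_1 v = 1" using k by simp
  have "(B *\<^sub>v v) $ i = B $$ (i, k)" if i: "i < n" for i
    using B k i by (simp add: v_def)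
  then have "vec_norm_1 (B *\<^sub>v v) = ?c k"
    unfolding vec_norm_1_def using B by (intro sum.cong) auto
  then have "vec_norm_1 (B *\<^sub>v v) / vec_norm_1 v = Max (?c ` {..<n})"
    using nv k(2) by simp
  then show "Max (?c ` {..<n}) \<in> (\<lambda>v. vec_norm_1 (B *\<^sub>v v) / vec_norm_1 v) `
      (carrier_vec (dim_col B) - {0\<^sub>v (dim_col B)})"
    using v v0 B by (intro image_eqI[of _ _ v]) auto
next
  fix x assume "x \<in> (\<lambda>v. vec_norm_1 (B *\<^sub>v v) / vec_norm_1 v) `
      (carrier_vec (dim_col B) - {0\<^sub>v (dim_col B)})"
  then obtain v where v: "v \<in> carrier_vec n - {0\<^sub>v n}" "x = vec_norm_1 (B *\<^sub>v v) / vec_norm_1 v"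
    using B by auto
  then have vc: "v \<in> carrier_vec n" by simp
  obtain i0 where "i0 < n" "v $ i0 \<noteq> 0" by (rule nonzero_vec_index[OF v(1)])
  then have pos: "0 < vec_norm_1 v"
    unfolding vec_norm_1_def using vc by (intro sum_pos2[of _ i0]) auto
  have "vec_norm_1 (B *\<^sub>v v) = (\<Sum>i<n. \<bar>\<Sum>j<n. B $$ (i, j) * v $ j\<bar>)"
    unfolding vec_norm_1_def using B mult_mat_vec_index[OF B vc] by (intro sum.cong) auto
  also have "\<dots> \<le> (\<Sum>i<n. \<Sum>j<n. \<bar>B $$ (i, j)\<bar> * \<bar>v $ j\<bar>)"
    by (intro sum_mono order_trans[OF sum_abs]) (simp add: abs_mult)
  also have "\<dots> = (\<Sum>j<n. ?c j * \<bar>v $ j\<bar>)"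
    by (subst sum.swap) (simp add: sum_distrib_right)
  also have "\<dots> \<le> (\<Sum>j<n. Max (?c ` {..<n}) * \<bar>v $ j\<bar>)"
    by (intro sum_mono mult_right_mono Max_ge) auto
  also have "\<dots> = Max (?c ` {..<n}) * vec_norm_1 v"
    using vc by (simp add: vec_norm_1_def sum_distrib_left)
  finally show "x \<le> Max (?c ` {..<n})" unfolding v(2) using pos by (simp add: pos_divide_le_eq)
qed

lemma induced_norm_inf_transpose:
  assumes "B \<in> carrier_mat n n" "0 < n"
  shows "induced_norm vec_norm_inf B\<^sup>T = induced_norm vec_norm_1 B"
proof -
  have "(\<lambda>i. \<Sum>j<n. \<bar>B\<^sup>T $$ (i, j)\<bar>) ` {..<n} = (\<lambda>j. \<Sum>i<n. \<bar>B $$ (i, j)\<bar>) ` {..<n}"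
    using assms by (intro image_cong sum.cong) auto
  then show ?thesis using assms by (simp add: induced_norm_1 induced_norm_inf[of _ n])
qed

text \<open>\<open>mat_inv\<close> strips an option: invertibility first rules out
  \<open>None\<close>, then uniqueness of two-sided inverses identifies the value.\<close>

lemma mat_inv_eq:
  assumes A: "A \<in> carrier_mat n n" and B: "B \<in> carrier_mat n n" "A * B = 1\<^sub>m n" "B * A = 1\<^sub>m n"
  shows "mat_inv A = B"
proof -
  have "A \<in> Units (ring_mat TYPE(real) n ())"
    using A B unfolding Units_def by (auto simp: ring_mat_simps)
  then obtain B' where some: "mat_inverse A = Some B'"
    using mat_inverse(1)[OF A, where b = "()"] by (cases "mat_inverse A") auto
  then have B': "A * B' = 1\<^sub>m n" "B' * A = 1\<^sub>m n" "B' \<in> carrier_mat n n"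
    using mat_inverse(2)[OF A] by auto
  have "B' = (B * A) * B'" using B B' by simp
  also have "\<dots> = B * (A * B')" by (rule assoc_mult_mat[OF B(1) A B'(3)])
  also have "\<dots> = B" using B B' by simp
  finally show ?thesis by (simp add: mat_inv_def some)
qed

lemma kappa_inf_mono:
  assumes M: "M \<in> carrier_mat n n" and N: "N \<in> carrier_mat n n" "M * N = 1\<^sub>m n" "N * M = 1\<^sub>m n"
    and E: "E \<in> carrier_mat n n" and F: "F \<in> carrier_mat n n" "E * F = 1\<^sub>m n" "F * E = 1\<^sub>m n"
    and nonneg: "\<And>i j. i < n \<Longrightarrow> j < n \<Longrightarrow> 0 \<le> M $$ (i, j)" "\<And>i j. i < n \<Longrightarrow> j < n \<Longrightarrow> 0 \<le> E $$ (i, j)"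
    and stoch: "\<And>i. i < n \<Longrightarrow> (\<Sum>j<n. E $$ (i, j)) = 1"
    and le: "\<And>i j. i < n \<Longrightarrow> j < n \<Longrightarrow> \<bar>N $$ (i, j)\<bar> \<le> \<bar>(F * N) $$ (i, j)\<bar>"
    and n: "0 < n"
  shows "kappa_inf M \<le> kappa_inf (M * E)"
proof -
  have ME: "M * E \<in> carrier_mat n n" and FN: "F * N \<in> carrier_mat n n" using M E F N by auto
  have "(M * E) * (F * N) = M * ((E * F) * N)" "(F * N) * (M * E) = F * ((N * M) * E)"
    using M E F(1) N(1) by (simp_all add: assoc_mult_mat[of _ n n _ n _ n])
  then have "(M * E) * (F * N) = 1\<^sub>m n" "(F * N) * (M * E) = 1\<^sub>m n"
    using M E F N by simp_all
  then have inv: "mat_inv M = N" "mat_inv (M * E) = F * N"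
    using mat_inv_eq[OF M N] mat_inv_eq[OF ME FN] by auto
  have rows: "(\<Sum>j<n. \<bar>(M * E) $$ (i, j)\<bar>) = (\<Sum>j<n. \<bar>M $$ (i, j)\<bar>)" if i: "i < n" for i
  proof -
    have "0 \<le> (\<Sum>k<n. M $$ (i, k) * E $$ (k, j))" if "j < n" for j
      using nonneg i that by (intro sum_nonneg) auto
    then have "(\<Sum>j<n. \<bar>(M * E) $$ (i, j)\<bar>) = (\<Sum>j<n. \<Sum>k<n. M $$ (i, k) * E $$ (k, j))"
      using i by (intro sum.cong refl) (simp add: mult_mat_index[OF M E] del: index_mult_mat)
    \<comment> \<open>Swapping the sums isolates the row sums of \<open>E\<close>, which are 1; as
      \<open>M\<close> and \<open>E\<close> are nonnegative, the absolute row sums of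
      \<open>M\<close> are preserved exactly.\<close>
    also have "\<dots> = (\<Sum>k<n. M $$ (i, k) * (\<Sum>j<n. E $$ (k, j)))"
      by (subst sum.swap) (simp add: sum_distrib_left)
    also have "\<dots> = (\<Sum>j<n. \<bar>M $$ (i, j)\<bar>)"
      using nonneg i stoch by (intro sum.cong) auto
    finally show ?thesis .
  qed
  have "induced_norm vec_norm_inf (M * E) = induced_norm vec_norm_inf M"
    unfolding induced_norm_inf[OF M n] induced_norm_inf[OF ME n]
    using rows by (metis (no_types, lifting) image_cong lessThan_iff)
  \<comment> \<open>The sign of the common factor is needed to multiply the inequality between the
    norms of the inverses by it.\<close>
  moreover have "0 \<le> induced_norm vec_norm_inf M"
  proof -
    have "0 \<le> (\<Sum>j<n. \<bar>M $$ (0, j)\<bar>)" by (simp add: sum_nonneg)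
    also have "\<dots> \<le> induced_norm vec_norm_inf M"
      unfolding induced_norm_inf[OF M n] using n by (intro Max_ge) auto
    finally show ?thesis .
  qed
  moreover have "induced_norm vec_norm_inf N \<le> induced_norm vec_norm_inf (F * N)"
    unfolding induced_norm_inf[OF N(1) n] induced_norm_inf[OF FN n]
  proof (rule Max.boundedI)
    fix a assume "a \<in> (\<lambda>i. \<Sum>j<n. \<bar>N $$ (i, j)\<bar>) ` {..<n}"
    then obtain i where i: "i < n" "a = (\<Sum>j<n. \<bar>N $$ (i, j)\<bar>)" by auto
    have "a \<le> (\<Sum>j<n. \<bar>(F * N) $$ (i, j)\<bar>)"
      unfolding i(2) using le[OF i(1)] by (intro sum_mono) auto
    also have "\<dots> \<le> Max ((\<lambda>i. \<Sum>j<n. \<bar>(F * N) $$ (i, j)\<bar>) ` {..<n})"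
      using i(1) by (intro Max_ge) auto
    finally show "a \<le> Max ((\<lambda>i. \<Sum>j<n. \<bar>(F * N) $$ (i, j)\<bar>) ` {..<n})" .
  qed (use n in auto)
  ultimately show ?thesis
    unfolding cond_number_def inv by (simp add: mult_left_mono)
qed

section \<open>Elementary matrices and their inverses\<close>

text \<open>In a sum without cancellation, the single term through the diagonal of \<open>F\<close>
  is already a lower bound. Both orders occur: the inverse of M E is F N, that of E^T M is N
  F^T.\<close>

lemma abs_le_checkerboard_mult:
  assumes F: "F \<in> carrier_mat n n" "checkerboard F" and B: "B \<in> carrier_mat n n" "checkerboard B"
    and diag: "\<And>i. i < n \<Longrightarrow> 1 \<le> \<bar>F $$ (i, i)\<bar>" and ij: "i < n" "j < n"
  shows "\<bar>B $$ (i, j)\<bar> \<le> \<bar>(F * B) $$ (i, j)\<bar>" "\<bar>B $$ (i, j)\<bar> \<le> \<bar>(B * F) $$ (i, j)\<bar>"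
proof -
  have "1 * \<bar>B $$ (i, j)\<bar> \<le> \<bar>F $$ (i, i)\<bar> * \<bar>B $$ (i, j)\<bar>"
    using diag[OF ij(1)] by (intro mult_right_mono) auto
  also have "\<dots> \<le> (\<Sum>k<n. \<bar>F $$ (i, k)\<bar> * \<bar>B $$ (k, j)\<bar>)"
    using ij by (intro member_le_sum) auto
  finally show "\<bar>B $$ (i, j)\<bar> \<le> \<bar>(F * B) $$ (i, j)\<bar>"
    using abs_checkerboard_mult[OF F B ij] by simp
  have "\<bar>B $$ (i, j)\<bar> * 1 \<le> \<bar>B $$ (i, j)\<bar> * \<bar>F $$ (j, j)\<bar>"
    using diag[OF ij(2)] by (intro mult_left_mono) auto
  also have "\<dots> \<le> (\<Sum>k<n. \<bar>B $$ (i, k)\<bar> * \<bar>F $$ (k, j)\<bar>)"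
    using ij by (intro member_le_sum[of j _ "\<lambda>k. \<bar>B $$ (i, k)\<bar> * \<bar>F $$ (k, j)\<bar>"]) auto
  finally show "\<bar>B $$ (i, j)\<bar> \<le> \<bar>(B * F) $$ (i, j)\<bar>"
    using abs_checkerboard_mult[OF B F ij] by simp
qed

text \<open>
  A common form of \<open>U_mat\<close> (with \<open>q = p + 1\<close>) and \<open>L_mat\<close> (with \<open>p = q + 1\<close>), closed under products,
  so that inverses are obtained by solving for the parameter.
\<close>

definition elem_mat :: "nat \<Rightarrow> nat \<Rightarrow> nat \<Rightarrow> real \<Rightarrow> real mat" where
  "elem_mat n p q a = mat n n (\<lambda>(r, c).
     if r = p then (if c = p then 1 - a else if c = q then a else 0) else if r = c then 1 else 0)"

lemma elem_mat_carrier [simp]: "elem_mat n p q a \<in> carrier_mat n n"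
  by (simp add: elem_mat_def)

lemma elem_mat_sum:
  assumes pq: "p < n" "q < n" "p \<noteq> q" and i: "i < n"
  shows "(\<Sum>k<n. elem_mat n p q a $$ (i, k) * f k) =
    (if i = p then (1 - a) * f p + a * f q else f i)"
proof -
  have "(\<Sum>k<n. elem_mat n p q a $$ (i, k) * f k) =
    (\<Sum>k<n. (if k = p then (if i = p then (1 - a) * f p else 0) else 0) +
      (if k = q then (if i = p then a * f q else 0) else 0) +
      (if k = i then (if i = p then 0 else f i) else 0))"
    using i pq by (intro sum.cong) (auto simp: elem_mat_def)
  also have "\<dots> = (if i = p then (1 - a) * f p + a * f q else f i)"
    using i pq by (simp add: sum.distrib)
  finally show ?thesis .
qed

text \<open>With R = e_p (e_q - e_p)^T the matrices are I + a R, and R^2 = -R. Equivalently, the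
  factors 1 - a multiply.\<close>

lemma elem_mat_mult:
  assumes pq: "p < n" "q < n" "p \<noteq> q"
  shows "elem_mat n p q a * elem_mat n p q b = elem_mat n p q (a + b - a * b)"
proof (rule eq_matI)
  fix i j assume "i < dim_row (elem_mat n p q (a + b - a * b))" "j < dim_col (elem_mat n p q (a + b - a * b))"
  then have ij: "i < n" "j < n" by (auto simp: elem_mat_def)
  show "(elem_mat n p q a * elem_mat n p q b) $$ (i, j) = elem_mat n p q (a + b - a * b) $$ (i, j)"
    unfolding mult_mat_index[OF elem_mat_carrier elem_mat_carrier ij] elem_mat_sum[OF pq ij(1)]
    using ij pq by (auto simp: elem_mat_def algebra_simps)
qed (auto simp: elem_mat_def)

lemma elementary_factor:
  assumes i: "2 \<le> i" "i \<le> n" and l: "0 \<le> l" "l < 1"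
    and E: "E = U_mat n i l \<or> E = L_mat n i l"
  obtains F where "F \<in> carrier_mat n n" "E * F = 1\<^sub>m n" "F * E = 1\<^sub>m n" "checkerboard F"
    "\<And>j. j < n \<Longrightarrow> 1 \<le> \<bar>F $$ (j, j)\<bar>"
    "\<And>j k. j < n \<Longrightarrow> k < n \<Longrightarrow> 0 \<le> E $$ (j, k)"
    "\<And>j. j < n \<Longrightarrow> (\<Sum>k<n. E $$ (j, k)) = 1" "E \<in> carrier_mat n n"
proof -
  \<comment> \<open>Since i >= 2, the truncated subtractions are exact and the two positions are
    distinct and adjacent.\<close>
  have "U_mat n i l = elem_mat n (i - 2) (i - 1) l" "L_mat n i l = elem_mat n (i - 1) (i - 2) l"
    unfolding U_mat_def L_mat_def elem_mat_def using i by (intro cong_mat; auto)+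
  then obtain p q where pq: "p < n" "q < n" "p \<noteq> q" "p = Suc q \<or> q = Suc p"
    and E: "E = elem_mat n p q l"
    using E i by (elim disjE) (auto intro: that[of "i - 2" "i - 1"] that[of "i - 1" "i - 2"])
  \<comment> \<open>\<open>m\<close> solves (1 - l)(1 - m) = 1. As m <= 0, the diagonal entry 1 - m
    is at least 1.\<close>
  define m where "m = - l / (1 - l)"
  define F where "F = elem_mat n p q m"
  have m: "m \<le> 0" using l by (simp add: m_def divide_nonpos_pos)
  have lm: "l + m - l * m = 0" using l by (simp add: m_def field_simps)
  have one: "elem_mat n p q 0 = 1\<^sub>m n" by (intro eq_matI) (auto simp: elem_mat_def)
  show thesis
  proof (rule that)
    show "F \<in> carrier_mat n n" "E \<in> carrier_mat n n" by (simp_all add: F_def E)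
    show "E * F = 1\<^sub>m n" "F * E = 1\<^sub>m n"
      using lm one by (simp_all add: E F_def elem_mat_mult[OF pq(1-3)] add.commute mult.commute)
    \<comment> \<open>The only other entry that can be nonzero off the diagonal is m <= 0 at (p, q),
      where p + q is odd by adjacency.\<close>
    show "checkerboard F"
      using m pq by (auto simp: checkerboard_def F_def elem_mat_def simp flip: mult_2)
    show "1 \<le> \<bar>F $$ (j, j)\<bar>" if "j < n" for j
      using that m by (auto simp: F_def elem_mat_def)
    show "0 \<le> E $$ (j, k)" if "j < n" "k < n" for j k
      using that l by (auto simp: E elem_mat_def)
    show "(\<Sum>k<n. E $$ (j, k)) = 1" if "j < n" for j
      using elem_mat_sum[OF pq(1-3) that, of l "\<lambda>_. 1"] by (simp add: E)
  qed
qed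

section \<open>The four comparisons for M E and E^T M\<close>

theorem theorem3p1:
  fixes n i :: nat and l :: real and M E A C :: "real mat"
  assumes "M \<in> carrier_mat n n"
    and "invertible_mat M"
    and "totally_positive M"
    and "2 \<le> i" and "i \<le> n"
    and "0 \<le> l" and "l < 1"
    and "E = U_mat n i l \<or> E = L_mat n i l"
    and "A = M * E"
    and "C = E\<^sup>T * M"
  shows "(dominates (abs_mat (mat_inv A)) (mat_inv M) \<and>
          dominates (abs_mat (mat_inv C)) (mat_inv M)) \<and>
         (min_eigenvalue A \<le> min_eigenvalue M \<and>
          min_eigenvalue C \<le> min_eigenvalue M) \<and>
         (min_singular_value A \<le> min_singular_value M \<and>
          min_singular_value C \<le> min_singular_value M) \<and>
         (kappa_inf M \<le> kappa_inf A \<and> kappa_1 M \<le> kappa_1 C)"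
proof -
  note M = assms(1) and tp = assms(3) and A = assms(9) and C = assms(10)
  have n: "0 < n" using assms(4,5) by simp
  obtain N where N: "N \<in> carrier_mat n n" "M * N = 1\<^sub>m n" "N * M = 1\<^sub>m n"
  proof -
    obtain N where N: "M * N = 1\<^sub>m (dim_row M)" "N * M = 1\<^sub>m (dim_row N)"
      using assms(2) by (auto simp: invertible_mat_def inverts_mat_def)
    \<comment> \<open>The invertibility witness comes without dimensions; they are read off from the
      two products.\<close>
    have "dim_col N = n" "dim_row N = n"
      using arg_cong[OF N(1), of dim_col] arg_cong[OF N(2), of dim_col] M by auto
    with N M show thesis by (intro that[of N]) auto
  qed
  obtain F where F: "F \<in> carrier_mat n n" "E * F = 1\<^sub>m n" "F * E = 1\<^sub>m n"
    and cbF: "checkerboard F" and diag: "\<And>j. j < n \<Longrightarrow> 1 \<le> \<bar>F $$ (j, j)\<bar>"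
    and E0: "\<And>j k. j < n \<Longrightarrow> k < n \<Longrightarrow> 0 \<le> E $$ (j, k)"
    and E1: "\<And>j. j < n \<Longrightarrow> (\<Sum>k<n. E $$ (j, k)) = 1" and E: "E \<in> carrier_mat n n"
    by (rule elementary_factor[OF assms(4-8)]) blast
  note cbN = totally_positive_inverse_checkerboard[OF M tp N]
  have cbFT: "checkerboard F\<^sup>T" by (rule checkerboard_transpose[OF cbF])
  have FT: "F\<^sup>T \<in> carrier_mat n n" and ET: "E\<^sup>T \<in> carrier_mat n n" using F E by auto
  have EFT: "E\<^sup>T * F\<^sup>T = 1\<^sub>m n" "F\<^sup>T * E\<^sup>T = 1\<^sub>m n"
    using transpose_mult_one E F by blast+
  have diagT: "1 \<le> \<bar>F\<^sup>T $$ (j, j)\<bar>" if "j < n" for j using diag[OF that] F(1) that by simp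
  define B where "B = F * N"
  define D where "D = N * F\<^sup>T"
  have car: "A \<in> carrier_mat n n" "C \<in> carrier_mat n n" "B \<in> carrier_mat n n" "D \<in> carrier_mat n n"
    using M E F N by (auto simp: A C B_def D_def)
  have "A * B = M * ((E * F) * N)" "B * A = F * ((N * M) * E)"
    "C * D = E\<^sup>T * ((M * N) * F\<^sup>T)" "D * C = N * ((F\<^sup>T * E\<^sup>T) * M)"
    using M E F(1) N(1) by (simp_all add: A B_def C D_def assoc_mult_mat[of _ n n _ n _ n])
  then have inv: "A * B = 1\<^sub>m n" "B * A = 1\<^sub>m n" "C * D = 1\<^sub>m n" "D * C = 1\<^sub>m n"
    using M E F N EFT FT ET by simp_all
  have mat_inv: "mat_inv M = N" "mat_inv A = B" "mat_inv C = D"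
    using mat_inv_eq[OF M N] mat_inv_eq[OF car(1,3) inv(1,2)] mat_inv_eq[OF car(2,4) inv(3,4)] .
  have cb: "checkerboard B" "checkerboard D"
    unfolding B_def D_def using F(1) N(1) FT cbF cbFT cbN by (auto intro!: checkerboard_mult)
  have le: "\<bar>N $$ (j, k)\<bar> \<le> \<bar>B $$ (j, k)\<bar>" "\<bar>N $$ (j, k)\<bar> \<le> \<bar>D $$ (j, k)\<bar>"
    if "j < n" "k < n" for j k
    unfolding B_def D_def
    using abs_le_checkerboard_mult(1)[OF F(1) cbF N(1) cbN diag that]
      abs_le_checkerboard_mult(2)[OF FT cbFT N(1) cbN diagT that] by auto
  note pos = totally_positive_eigenvalue_pos[OF M tp N(1,2)]
  have "dominates (abs_mat B) N" "dominates (abs_mat D) N"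
    using le car N(1) by (auto simp: dominates_def abs_mat_def)
  moreover have "min_eigenvalue A \<le> min_eigenvalue M"
    by (rule min_eigenvalue_mono[OF M N car(1,3) inv(1) cbN cb(1) le(1) n pos])
  moreover have "min_eigenvalue C \<le> min_eigenvalue M"
    by (rule min_eigenvalue_mono[OF M N car(2,4) inv(3) cbN cb(2) le(2) n pos])
  moreover have "min_singular_value A \<le> min_singular_value M"
    by (rule min_singular_value_mono[OF M N car(1,3) inv(1,2) cbN cb(1) le(1) n])
  moreover have "min_singular_value C \<le> min_singular_value M"
    by (rule min_singular_value_mono[OF M N car(2,4) inv(3,4) cbN cb(2) le(2) n])
  moreover have "kappa_inf M \<le> kappa_inf A"
    unfolding A
    by (rule kappa_inf_mono[OF M N E F totally_positive_nonneg[OF M tp] E0 E1 le(1)[unfolded B_def] n])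
  moreover have "kappa_1 M \<le> kappa_1 C"
  \<comment> \<open>Transposition reduces this to the infinity norm: C^T = M^T E, with inverse D^T =
    F N^T, and \<open>kappa_inf_mono\<close> asks only for nonnegative entries of M^T.\<close>
  proof -
    have MT: "M\<^sup>T \<in> carrier_mat n n" and NT: "N\<^sup>T \<in> carrier_mat n n" using M N by auto
    have MNT: "M\<^sup>T * N\<^sup>T = 1\<^sub>m n" "N\<^sup>T * M\<^sup>T = 1\<^sub>m n"
      using transpose_mult_one M N by blast+
    have DT: "D\<^sup>T = F * N\<^sup>T" and CT: "C\<^sup>T = M\<^sup>T * E"
      unfolding D_def C using transpose_mult[OF N(1) FT] transpose_mult[OF ET M] by simp_all
    have CD: "C\<^sup>T * D\<^sup>T = 1\<^sub>m n" "D\<^sup>T * C\<^sup>T = 1\<^sub>m n"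
      using transpose_mult_one car inv by blast+
    have "kappa_inf M\<^sup>T \<le> kappa_inf (M\<^sup>T * E)"
    proof (rule kappa_inf_mono[OF MT NT MNT E F _ E0 E1 _ n])
      show "0 \<le> M\<^sup>T $$ (j, k)" if "j < n" "k < n" for j k
        using totally_positive_nonneg[OF M tp that(2,1)] M that by simp
      show "\<bar>N\<^sup>T $$ (j, k)\<bar> \<le> \<bar>(F * N\<^sup>T) $$ (j, k)\<bar>" if "j < n" "k < n" for j k
        using le(2)[OF that(2,1)] car(4) N(1) that by (simp flip: DT)
    qed
    also have "M\<^sup>T * E = C\<^sup>T" by (simp add: CT)
    finally have "kappa_inf M\<^sup>T \<le> kappa_inf C\<^sup>T" .
    moreover have "mat_inv M\<^sup>T = N\<^sup>T" "mat_inv C\<^sup>T = D\<^sup>T"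
      using mat_inv_eq[OF MT NT MNT] mat_inv_eq[OF _ _ CD] car by auto
    ultimately show ?thesis
      using M N(1) car n by (simp add: cond_number_def mat_inv induced_norm_inf_transpose)
  qed
  ultimately show ?thesis unfolding mat_inv by blast
qed

end
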